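(* Let $\mathcal{T}\ge 1$, $n\ge 1$, $\epsilon>0$, let $\mathbf{C}\in\mathbb{R}^{n^{\mathcal{T}+1}}$ be a $(\mathcal{T}+1)$-mode cost tensor, and for $t=0,\dots,\mathcal{T}$ let $G_t\in\mathbb{R}^{m_t\times n}$, $r_t\in\mathbb{R}^{m_t}$ and $0<\gamma_t<\infty$. Consider the entropy regularized multi-marginal optimal mass transport problem with partial information $$\min_{\mathbf{M},\,\Delta_0,\dots,\Delta_{\mathcal{T}}}\ \langle\mathbf{C},\mathbf{M}\rangle+\epsilon\,\mathcal{D}(\mathbf{M})+\sum_{t=0}^{\mathcal{T}}\gamma_t\|\Delta_t\|_2^2\quad\text{subject to}\quad G_tP_t(\mathbf{M})=r_t+\Delta_t,\quad t=0,\dots,\mathcal{T},$$ whose Lagrange dual problem (up to an additive constant in the objective) is $$\max_{\lambda_0\in\mathbb{R}^{m_0},\dots,\lambda_{\mathcal{T}}\in\mathbb{R}^{m_{\mathcal{T}}}}\ g(\lambda_0,\dots,\lambda_{\mathcal{T}}):=-\epsilon\,\langle\mathbf{K},\mathbf{U}\rangle-\sum_{t=0}^{\mathcal{T}}\frac{1}{4\gamma_t}\|\lambda_t\|_2^2+\sum_{t=0}^{\mathcal{T}}\lambda_t^Tr_t,$$ where $\mathbf{K}=\exp(-\mathbf{C}/\epsilon)$, $\mathbf{U}=u_0\otimes u_1\otimes\cdots\otimes u_{\mathcal{T}}$ and $u_t=\exp(G_t^T\lambda_t/\epsilon)$ for $t=0,\dots,\mathcal{T}$. Given an initial set of vectors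 $\lambda_0,\dots,\lambda_{\mathcal{T}}$, the following iteration (with $t$ running through $0,\dots,\mathcal{T}$ repeatedly) is a block-coordinate ascent method for this dual problem: (1) Let $v_t=P_t(\mathbf{K}\odot\mathbf{U})./u_t$, where $\mathbf{U}=u_0\otimes\cdots\otimes u_{\mathcal{T}}$ and $u_s=\exp(G_s^T\lambda_s/\epsilon)$, $s=0,\dots,\mathcal{T}$, are computed from the current vectors $\lambda_0,\dots,\lambda_{\mathcal{T}}$. (2) Update the vector $\lambda_t$ as the solution of $$G_t\Big(v_t\odot\exp\Big(\frac{G_t^T\lambda_t}{\epsilon}\Big)\Big)+\frac{\lambda_t}{2\gamma_t}-r_t=0 .$$ That is, for each $t$, with the other dual variables $\lambda_s$, $s\neq t$, kept fixed at their current values, the vector $\lambda_t$ obtained in step (2) is the maximizer of $g$ with respect to $\lambda_t$.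
   Context: Tensors $\mathbf{M},\mathbf{C},\mathbf{K},\mathbf{U}\in\mathbb{R}^{n^{\mathcal{T}+1}}$ are real arrays indexed by $(i_0,\dots,i_{\mathcal{T}})\in\{1,\dots,n\}^{\mathcal{T}+1}$. The symbols $\odot$, $./$, $\exp$, $\log$ denote elementwise multiplication, division, exponential and logarithm. The inner product is $\langle\mathbf{A},\mathbf{B}\rangle=\sum_{i_0,\dots,i_{\mathcal{T}}}\mathbf{A}_{i_0,\dots,i_{\mathcal{T}}}\mathbf{B}_{i_0,\dots,i_{\mathcal{T}}}$. The tensor $u_0\otimes\cdots\otimes u_{\mathcal{T}}$ has entries $\prod_{t=0}^{\mathcal{T}}(u_t)_{i_t}$. The projection $P_t:\mathbb{R}^{n^{\mathcal{T}+1}}\to\mathbb{R}^n$ on the $t$-th marginal is $P_t(\mathbf{M})_j=\sum_{i_0,\dots,i_{t-1},i_{t+1},\dots,i_{\mathcal{T}}}\mathbf{M}_{i_0,\dots,i_{t-1},j,i_{t+1},\dots,i_{\mathcal{T}}}$. The entropy term is $\mathcal{D}(\mathbf{M})=\sum_{i_0,\dots,i_{\mathcal{T}}}\big(\mathbf{M}_{i_0,\dots,i_{\mathcal{T}}}\log\mathbf{M}_{i_0,\dots,i_{\mathcal{T}}}-\mathbf{M}_{i_0,\dots,i_{\mathcal{T}}}+1\big)$, defined for entrywise nonnegative $\mathbf{M}$ with $0\log 0=0$. A block-coordinate ascent method for maximizing $g(\lambda_0,\dots,\lambda_{\mathcal{T}})$ is one which iteratively updates one block $\lambda_t$ at a time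 so as to maximize $g$ with respect to $\lambda_t$ while the other blocks are kept fixed. *)

theory Defs
  imports "HOL-Library.Extended_Real" "HOL-Library.FuncSet" "Jordan_Normal_Form.Matrix"
begin

text \<open>
  The modes are \<open>0, \<dots>, T\<close>, and all coordinates are counted from \<open>0\<close>.  A tensor with
  \<open>T + 1\<close> modes of size \<open>n\<close> is a real function of multi-indices; only its values on
  \<open>tensor_index T n\<close> matter.  Families of vectors and matrices indexed by the modes are functions
  on \<open>nat\<close>, of which only the values at \<open>t \<le> T\<close> matter.
\<close>

type_synonym tensor = "(nat \<Rightarrow> nat) \<Rightarrow> real"

definition tensor_index :: "nat \<Rightarrow> nat \<Rightarrow> (nat \<Rightarrow> nat) set" where
  "tensor_index T n = {..T} \<rightarrow>\<^sub>E {..<n}"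

definition tensor_inner :: "nat \<Rightarrow> nat \<Rightarrow> tensor \<Rightarrow> tensor \<Rightarrow> real" where
  "tensor_inner T n A B = (\<Sum>i\<in>tensor_index T n. A i * B i)"

definition tensor_mult :: "tensor \<Rightarrow> tensor \<Rightarrow> tensor" where
  "tensor_mult A B = (\<lambda>i. A i * B i)"

definition tensor_prod :: "nat \<Rightarrow> (nat \<Rightarrow> real vec) \<Rightarrow> tensor" where
  "tensor_prod T u = (\<lambda>i. \<Prod>t\<le>T. u t $ i t)"

definition marginal :: "nat \<Rightarrow> nat \<Rightarrow> nat \<Rightarrow> tensor \<Rightarrow> real vec" where
  "marginal T n t M = vec n (\<lambda>j. \<Sum>i | i \<in> tensor_index T n \<and> i t = j. M i)"

text \<open>Since \<open>0 * ln 0 = 0\<close>, the convention for vanishing entries holds automatically.\<close>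

definition entropy :: "nat \<Rightarrow> nat \<Rightarrow> tensor \<Rightarrow> real" where
  "entropy T n M = (\<Sum>i\<in>tensor_index T n. M i * ln (M i) - M i + 1)"

definition vec_mult :: "real vec \<Rightarrow> real vec \<Rightarrow> real vec" where
  "vec_mult v w = vec (dim_vec v) (\<lambda>j. v $ j * w $ j)"

definition vec_divide :: "real vec \<Rightarrow> real vec \<Rightarrow> real vec" where
  "vec_divide v w = vec (dim_vec v) (\<lambda>j. v $ j / w $ j)"

definition sq_norm2 :: "real vec \<Rightarrow> real" where
  "sq_norm2 v = (\<Sum>j<dim_vec v. (v $ j)\<^sup>2)"

definition block_vectors :: "nat \<Rightarrow> (nat \<Rightarrow> nat) \<Rightarrow> (nat \<Rightarrow> real vec) set" where
  "block_vectors T m = {x. \<forall>t\<le>T. x t \<in> carrier_vec (m t)}"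

text \<open>
  The primal problem: minimize \<open>primal_objective\<close> over the pairs \<open>(M, \<Delta>)\<close> in \<open>primal_domain\<close>
  subject to \<open>primal_residual T n G r t (M, \<Delta>) = 0\<close> for all \<open>t \<le> T\<close>.  The domain contains the
  nonnegativity of \<open>M\<close>, which comes from the domain of the entropy and is not dualized.
\<close>

definition primal_domain ::
  "nat \<Rightarrow> nat \<Rightarrow> (nat \<Rightarrow> nat) \<Rightarrow> (tensor \<times> (nat \<Rightarrow> real vec)) set" where
  "primal_domain T n m = {M. \<forall>i\<in>tensor_index T n. 0 \<le> M i} \<times> block_vectors T m"

definition primal_objective ::
  "nat \<Rightarrow> nat \<Rightarrow> real \<Rightarrow> tensor \<Rightarrow> (nat \<Rightarrow> real) \<Rightarrow> tensor \<times> (nat \<Rightarrow> real vec) \<Rightarrow> real" where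
  "primal_objective T n eps C gam = (\<lambda>(M, \<Delta>).
     tensor_inner T n C M + eps * entropy T n M + (\<Sum>t\<le>T. gam t * sq_norm2 (\<Delta> t)))"

definition primal_residual ::
  "nat \<Rightarrow> nat \<Rightarrow> (nat \<Rightarrow> real mat) \<Rightarrow> (nat \<Rightarrow> real vec) \<Rightarrow> nat \<Rightarrow>
   tensor \<times> (nat \<Rightarrow> real vec) \<Rightarrow> real vec" where
  "primal_residual T n G r t = (\<lambda>(M, \<Delta>). r t + \<Delta> t - G t *\<^sub>v marginal T n t M)"

text \<open>
  The Lagrange dual function of the problem of minimizing \<open>f\<close> over \<open>X\<close> subject to \<open>h t x = 0\<close> for
  \<open>t \<le> T\<close>.
\<close>

definition lagrange_dual ::
  "nat \<Rightarrow> 'a set \<Rightarrow> ('a \<Rightarrow> real) \<Rightarrow> (nat \<Rightarrow> 'a \<Rightarrow> real vec) \<Rightarrow> (nat \<Rightarrow> real vec) \<Rightarrow> ereal" where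
  "lagrange_dual T X f h lam = (INF x\<in>X. ereal (f x + (\<Sum>t\<le>T. lam t \<bullet> h t x)))"

definition gibbs_kernel :: "real \<Rightarrow> tensor \<Rightarrow> tensor" where
  "gibbs_kernel eps C = (\<lambda>i. exp (- C i / eps))"

definition scaling :: "real \<Rightarrow> real mat \<Rightarrow> real vec \<Rightarrow> real vec" where
  "scaling eps G l = map_vec (\<lambda>z. exp (z / eps)) (transpose_mat G *\<^sub>v l)"

definition scaling_tensor ::
  "nat \<Rightarrow> real \<Rightarrow> (nat \<Rightarrow> real mat) \<Rightarrow> (nat \<Rightarrow> real vec) \<Rightarrow> tensor" where
  "scaling_tensor T eps G lam = tensor_prod T (\<lambda>t. scaling eps (G t) (lam t))"

definition dual_objective ::
  "nat \<Rightarrow> nat \<Rightarrow> real \<Rightarrow> tensor \<Rightarrow> (nat \<Rightarrow> real mat) \<Rightarrow> (nat \<Rightarrow> real vec) \<Rightarrow> (nat \<Rightarrow> real) \<Rightarrow>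
   (nat \<Rightarrow> real vec) \<Rightarrow> real" where
  "dual_objective T n eps C G r gam lam =
     - eps * tensor_inner T n (gibbs_kernel eps C) (scaling_tensor T eps G lam)
     - (\<Sum>t\<le>T. 1 / (4 * gam t) * sq_norm2 (lam t))
     + (\<Sum>t\<le>T. lam t \<bullet> r t)"

definition block_maximizer ::
  "(nat \<Rightarrow> nat) \<Rightarrow> ((nat \<Rightarrow> real vec) \<Rightarrow> real) \<Rightarrow> (nat \<Rightarrow> real vec) \<Rightarrow> nat \<Rightarrow> real vec \<Rightarrow> bool" where
  "block_maximizer m g lam t \<nu> \<longleftrightarrow>
     is_arg_max (\<lambda>\<mu>. g (lam(t := \<mu>))) (\<lambda>\<mu>. \<mu> \<in> carrier_vec (m t)) \<nu>"

text \<open>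
  \<open>x\<close> is a sequence of iterates of block-coordinate ascent for \<open>g\<close>, where \<open>b k\<close> is the block that is
  updated in step \<open>k\<close>.
\<close>

definition block_coordinate_ascent ::
  "nat \<Rightarrow> (nat \<Rightarrow> nat) \<Rightarrow> ((nat \<Rightarrow> real vec) \<Rightarrow> real) \<Rightarrow> (nat \<Rightarrow> nat) \<Rightarrow> (nat \<Rightarrow> nat \<Rightarrow> real vec) \<Rightarrow> bool"
  where
  "block_coordinate_ascent T m g b x \<longleftrightarrow>
     (\<forall>k. b k \<le> T \<and> x k \<in> block_vectors T m \<and>
       (\<exists>\<nu>. block_maximizer m g (x k) (b k) \<nu> \<and> x (Suc k) = (x k)(b k := \<nu>)))"

definition step_vector ::
  "nat \<Rightarrow> nat \<Rightarrow> real \<Rightarrow> tensor \<Rightarrow> (nat \<Rightarrow> real mat) \<Rightarrow> (nat \<Rightarrow> real vec) \<Rightarrow> nat \<Rightarrow> real vec" where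
  "step_vector T n eps C G lam t =
     vec_divide (marginal T n t (tensor_mult (gibbs_kernel eps C) (scaling_tensor T eps G lam)))
       (scaling eps (G t) (lam t))"

text \<open>
  \<open>\<nu>\<close> solves the update equation for block \<open>t\<close>; the vector \<open>v\<close> is computed from the current \<open>lam\<close>
  and not from the unknown \<open>\<nu>\<close>.
\<close>

definition solves_step ::
  "nat \<Rightarrow> nat \<Rightarrow> (nat \<Rightarrow> nat) \<Rightarrow> real \<Rightarrow> tensor \<Rightarrow> (nat \<Rightarrow> real mat) \<Rightarrow> (nat \<Rightarrow> real vec) \<Rightarrow>
   (nat \<Rightarrow> real) \<Rightarrow> (nat \<Rightarrow> real vec) \<Rightarrow> nat \<Rightarrow> real vec \<Rightarrow> bool" where
  "solves_step T n m eps C G r gam lam t \<nu> \<longleftrightarrow>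
     \<nu> \<in> carrier_vec (m t) \<and>
     (let v = step_vector T n eps C G lam t in
        G t *\<^sub>v vec_mult v (scaling eps (G t) \<nu>) + (1 / (2 * gam t)) \<cdot>\<^sub>v \<nu> - r t = 0\<^sub>v (m t))"

definition cyclic_block :: "nat \<Rightarrow> nat \<Rightarrow> nat" where
  "cyclic_block T k = k mod (T + 1)"

definition iteration ::
  "nat \<Rightarrow> nat \<Rightarrow> (nat \<Rightarrow> nat) \<Rightarrow> real \<Rightarrow> tensor \<Rightarrow> (nat \<Rightarrow> real mat) \<Rightarrow> (nat \<Rightarrow> real vec) \<Rightarrow>
   (nat \<Rightarrow> real) \<Rightarrow> (nat \<Rightarrow> real vec) \<Rightarrow> (nat \<Rightarrow> nat \<Rightarrow> real vec) \<Rightarrow> bool" where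
  "iteration T n m eps C G r gam lam0 x \<longleftrightarrow>
     x 0 = lam0 \<and>
     (\<forall>k. \<exists>\<nu>. solves_step T n m eps C G r gam (x k) (cyclic_block T k) \<nu> \<and>
              x (Suc k) = (x k)(cyclic_block T k := \<nu>))"

end

theory Submission
  imports Defs "HOL-Analysis.Function_Topology"
begin

text \<open>
  As a function of one block the dual objective is
  \<open>\<mu> \<mapsto> - \<epsilon> (\<Sum>j. v j * exp ((\<Sum>i. A i j * \<mu> i) / \<epsilon>)) - c |\<mu>|\<^sup>2 + \<mu> \<bullet> r\<close> with \<open>c = 1 / (4 \<gamma>)\<close>
  and \<open>v \<ge> 0\<close>, and the update equation says that its gradient vanishes.  The tangent inequality for
  \<open>exp\<close> bounds it by its tangent at any point minus \<open>c |\<mu> - \<nu>|\<^sup>2\<close>, so a zero \<open>\<nu>\<close> of the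
  gradient is the unique maximizer.  A zero exists because the quadratic term confines the maximum to
  a compact box.  In the Lagrangian the variables \<open>M i\<close> and \<open>\<Delta> t\<close> separate, so the dual function
  is computed by minimizing \<open>\<epsilon> (z ln z - z + 1) - p z\<close> over \<open>z \<ge> 0\<close> and completing a square.
\<close>

section \<open>The concave function of a single block\<close>

text \<open>Blocks are functions on \<open>nat\<close> here instead of vectors, so that the product
  topology supplies compactness and continuity. Only the coordinates below \<open>m\<close>
  enter.\<close>

definition block_objective ::
  "nat \<Rightarrow> nat \<Rightarrow> real \<Rightarrow> (nat \<Rightarrow> nat \<Rightarrow> real) \<Rightarrow> (nat \<Rightarrow> real) \<Rightarrow> real \<Rightarrow> (nat \<Rightarrow> real) \<Rightarrow> (nat \<Rightarrow> real) \<Rightarrow> real"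
  where
  "block_objective m n eps A v c r x =
     - eps * (\<Sum>j<n. v j * exp ((\<Sum>i<m. A i j * x i) / eps)) - c * (\<Sum>i<m. (x i)\<^sup>2) + (\<Sum>i<m. x i * r i)"

definition block_gradient ::
  "nat \<Rightarrow> nat \<Rightarrow> real \<Rightarrow> (nat \<Rightarrow> nat \<Rightarrow> real) \<Rightarrow> (nat \<Rightarrow> real) \<Rightarrow> real \<Rightarrow> (nat \<Rightarrow> real) \<Rightarrow> (nat \<Rightarrow> real) \<Rightarrow> nat \<Rightarrow> real"
  where
  "block_gradient m n eps A v c r x k =
     r k - 2 * c * x k - (\<Sum>j<n. A k j * (v j * exp ((\<Sum>i<m. A i j * x i) / eps)))"

text \<open>Each exponential lies above its tangent, and the weights \<open>v\<close> and
  \<open>eps\<close> preserve the inequality. The quadratic part equals its second-order expansion,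
  which leaves exactly the term with factor \<open>c\<close>.\<close>

lemma block_objective_strongly_concave:
  assumes eps: "0 < eps" and v: "\<And>j. j < n \<Longrightarrow> 0 \<le> v j"
  shows "block_objective m n eps A v c r y \<le> block_objective m n eps A v c r x
           + (\<Sum>k<m. block_gradient m n eps A v c r x k * (y k - x k)) - c * (\<Sum>k<m. (y k - x k)\<^sup>2)"
proof -
  define a where "a z j = (\<Sum>i<m. A i j * z i)" for z j
  have exp_le: "- eps * (v j * exp (a y j / eps)) \<le> - eps * (v j * exp (a x j / eps))
      - v j * exp (a x j / eps) * (a y j - a x j)" if "j < n" for j
  proof -
    have "exp (a x j / eps) * (1 + (a y j - a x j) / eps) \<le> exp (a x j / eps) * exp ((a y j - a x j) / eps)"
      by (intro mult_left_mono exp_ge_add_one_self) auto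
    also have "\<dots> = exp (a y j / eps)"
      by (simp add: exp_add[symmetric] add_divide_distrib[symmetric])
    finally have "eps * v j * (exp (a x j / eps) * (1 + (a y j - a x j) / eps)) \<le> eps * v j * exp (a y j / eps)"
      using eps v[OF that] by (intro mult_left_mono) auto
    moreover have "eps * v j * (exp (a x j / eps) * (1 + (a y j - a x j) / eps))
        = eps * v j * exp (a x j / eps) + v j * exp (a x j / eps) * (a y j - a x j)"
      using eps by (simp add: field_simps)
    ultimately show ?thesis by (simp add: algebra_simps)
  qed
  have "- eps * (\<Sum>j<n. v j * exp (a y j / eps))
      \<le> (\<Sum>j<n. - eps * (v j * exp (a x j / eps)) - v j * exp (a x j / eps) * (a y j - a x j))"
    unfolding sum_distrib_left by (intro sum_mono exp_le) auto
  also have "\<dots> = - eps * (\<Sum>j<n. v j * exp (a x j / eps))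
      - (\<Sum>j<n. v j * exp (a x j / eps) * (a y j - a x j))"
    by (simp add: sum_subtractf sum_distrib_left)
  also have "(\<Sum>j<n. v j * exp (a x j / eps) * (a y j - a x j))
      = (\<Sum>j<n. \<Sum>k<m. A k j * (v j * exp (a x j / eps)) * (y k - x k))"
    unfolding a_def sum_subtractf[symmetric] sum_distrib_left
    by (intro sum.cong refl) (simp add: algebra_simps)
  \<comment> \<open>Exchanging the sums collects the linear term by coordinates \<open>k\<close>,
    which is the exponential part of the gradient.\<close>
  also have "\<dots> = (\<Sum>k<m. (\<Sum>j<n. A k j * (v j * exp (a x j / eps))) * (y k - x k))"
    by (subst sum.swap) (simp add: sum_distrib_right)
  finally have exp_part: "- eps * (\<Sum>j<n. v j * exp (a y j / eps)) \<le>
      - eps * (\<Sum>j<n. v j * exp (a x j / eps))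
      - (\<Sum>k<m. (\<Sum>j<n. A k j * (v j * exp (a x j / eps))) * (y k - x k))" .
  have quad_part: "- c * (\<Sum>k<m. (y k)\<^sup>2) + (\<Sum>k<m. y k * r k)
      = - c * (\<Sum>k<m. (x k)\<^sup>2) + (\<Sum>k<m. x k * r k)
        + (\<Sum>k<m. (r k - 2 * c * x k) * (y k - x k)) - c * (\<Sum>k<m. (y k - x k)\<^sup>2)"
    unfolding sum_distrib_left sum.distrib[symmetric] sum_subtractf[symmetric]
    by (intro sum.cong refl) (simp add: algebra_simps power2_eq_square)
  have "(\<Sum>k<m. block_gradient m n eps A v c r x k * (y k - x k))
      = (\<Sum>k<m. (r k - 2 * c * x k) * (y k - x k))
        - (\<Sum>k<m. (\<Sum>j<n. A k j * (v j * exp (a x j / eps))) * (y k - x k))"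
    unfolding sum_subtractf[symmetric] block_gradient_def a_def
    by (intro sum.cong refl) (simp add: algebra_simps)
  with exp_part quad_part show ?thesis
    unfolding block_objective_def a_def[symmetric] by linarith
qed

text \<open>Completing the square centres the quadratic part at \<open>r / (2 * c)\<close>. Outside
  a suitable box around this centre the value is at most the value at the origin, so a maximum over
  the box is global.\<close>

lemma block_objective_attains_max:
  assumes eps: "0 < eps" and v: "\<And>j. j < n \<Longrightarrow> 0 \<le> v j" and c: "0 < c"
  shows "\<exists>x. \<forall>y. block_objective m n eps A v c r y \<le> block_objective m n eps A v c r x"
proof -
  let ?F = "block_objective m n eps A v c r"
  \<comment> \<open>\<open>S\<close> is chosen so that \<open>c * S\<close> is the constant left by
    completing the square minus the value \<open>- eps * (\<Sum>j<n. v j)\<close> at the origin.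
    Squared distance above \<open>S\<close> from the centre thus gives at most the value at the
    origin.\<close>
  define S where "S = (\<Sum>i<m. (r i / (2 * c))\<^sup>2) + eps * (\<Sum>j<n. v j) / c"
  \<comment> \<open>The coordinates from \<open>m\<close> on are pinned to 0, so that
    \<open>K\<close> is a product of compact sets and Tychonoff's theorem applies.\<close>
  define K where "K = (\<Pi>\<^sub>E i\<in>UNIV. if i < m then {r i / (2 * c) - sqrt S .. r i / (2 * c) + sqrt S} else {0})"
  have v_sum: "0 \<le> eps * (\<Sum>j<n. v j) / c"
    using eps c v by (intro divide_nonneg_pos mult_nonneg_nonneg sum_nonneg) auto
  have zero_in_K: "(\<lambda>i. 0) \<in> K"
  proof -
    have "r i / (2 * c) - sqrt S \<le> 0 \<and> 0 \<le> r i / (2 * c) + sqrt S" if "i < m" for i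
    proof -
      have "(r i / (2 * c))\<^sup>2 \<le> (\<Sum>i<m. (r i / (2 * c))\<^sup>2)"
        using that by (intro member_le_sum) auto
      then have "(r i / (2 * c))\<^sup>2 \<le> S" using v_sum unfolding S_def by linarith
      then have "\<bar>r i / (2 * c)\<bar> \<le> sqrt S" by (metis real_sqrt_abs real_sqrt_le_mono)
      then show ?thesis by linarith
    qed
    then show ?thesis unfolding K_def by (auto simp: PiE_UNIV_domain)
  qed
  have "compact K"
  proof -
    have "compact (PiE UNIV B)" if "\<And>i. compact (B i)" for B :: "nat \<Rightarrow> real set"
      using that compactin_PiE[of "\<lambda>_. euclidean" UNIV B] by (simp add: euclidean_product_topology)
    then show ?thesis unfolding K_def by simp
  qed
  moreover have "continuous_on K ?F"
    unfolding block_objective_def using eps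
    by (intro continuous_intros continuous_on_product_then_coordinatewise) auto
  ultimately obtain x where x: "x \<in> K" "\<And>y. y \<in> K \<Longrightarrow> ?F y \<le> ?F x"
    using continuous_attains_sup[of K ?F] zero_in_K by blast
  have "?F y \<le> ?F x" for y
  proof (cases "\<forall>i<m. \<bar>y i - r i / (2 * c)\<bar> \<le> sqrt S")
    case True
    \<comment> \<open>Zeroing the irrelevant coordinates moves \<open>y\<close> into
      \<open>K\<close> without changing the value.\<close>
    define z where "z i = (if i < m then y i else 0)" for i
    have "z \<in> K" unfolding K_def z_def using True by (fastforce simp: abs_le_iff)
    moreover have "?F z = ?F y" unfolding block_objective_def z_def by simp
    ultimately show ?thesis using x(2) by metis
  next
    case False
    \<comment> \<open>A single coordinate outside its interval already pushes the whole sum of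
      squares above \<open>S\<close>.\<close>
    then obtain i where i: "i < m" "sqrt S < \<bar>y i - r i / (2 * c)\<bar>" by force
    then have "S < (y i - r i / (2 * c))\<^sup>2"
      by (metis real_sqrt_abs real_sqrt_less_iff)
    also have "\<dots> \<le> (\<Sum>i<m. (y i - r i / (2 * c))\<^sup>2)"
      using i by (intro member_le_sum) auto
    finally have "c * S \<le> c * (\<Sum>i<m. (y i - r i / (2 * c))\<^sup>2)" using c by simp
    moreover have "c * S = c * (\<Sum>i<m. (r i / (2 * c))\<^sup>2) + eps * (\<Sum>j<n. v j)"
      using c by (simp add: S_def distrib_left)
    moreover have "- c * (\<Sum>i<m. (y i)\<^sup>2) + (\<Sum>i<m. y i * r i)
        = c * (\<Sum>i<m. (r i / (2 * c))\<^sup>2) - c * (\<Sum>i<m. (y i - r i / (2 * c))\<^sup>2)"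
      unfolding sum_distrib_left sum.distrib[symmetric] sum_subtractf[symmetric]
      using c by (intro sum.cong refl) (simp add: field_simps power2_eq_square)
    moreover have "0 \<le> eps * (\<Sum>j<n. v j * exp ((\<Sum>i<m. A i j * y i) / eps))"
      using eps v by (intro mult_nonneg_nonneg sum_nonneg) auto
    moreover have "?F (\<lambda>i. 0) = - eps * (\<Sum>j<n. v j)"
      by (simp add: block_objective_def)
    ultimately have "?F y \<le> ?F (\<lambda>i. 0)"
      unfolding block_objective_def by linarith
    also have "\<dots> \<le> ?F x" using x(2) zero_in_K by blast
    finally show ?thesis .
  qed
  then show ?thesis by blast
qed

lemma block_objective_has_derivative:
  assumes eps: "eps \<noteq> 0" and k: "k < m"
  shows "((\<lambda>s. block_objective m n eps A v c r (x(k := s))) has_real_derivative block_gradient m n eps A v c r x k)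
           (at (x k))"
proof -
  \<comment> \<open>This isolates the only summand depending on \<open>s\<close>; the rest is
    constant under differentiation.\<close>
  have split: "(\<Sum>i<m. f i ((x(k := s)) i)) = f k s + (\<Sum>i\<in>{..<m} - {k}. f i (x i))"
    for f :: "nat \<Rightarrow> real \<Rightarrow> real" and s
  proof -
    have "(\<Sum>i<m. f i ((x(k := s)) i)) = f k s + (\<Sum>i\<in>{..<m} - {k}. f i ((x(k := s)) i))"
      using k by (subst sum.remove[of _ k]) auto
    also have "(\<Sum>i\<in>{..<m} - {k}. f i ((x(k := s)) i)) = (\<Sum>i\<in>{..<m} - {k}. f i (x i))"
      by (intro sum.cong) auto
    finally show ?thesis .
  qed
  have whole: "(\<Sum>i<m. A i j * x i) = A k j * x k + (\<Sum>i\<in>{..<m} - {k}. A i j * x i)" for j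
    using k by (subst sum.remove[of _ k]) auto
  show ?thesis
    unfolding block_objective_def block_gradient_def split[of "\<lambda>i z. A i _ * z"] split[of "\<lambda>i z. z\<^sup>2"]
      split[of "\<lambda>i z. z * r i"] whole
    by (rule derivative_eq_intros refl | simp add: eps)+
       (simp add: eps sum_distrib_left algebra_simps sum_negf[symmetric] flip: sum_divide_distrib,
        simp add: eps flip: sum_distrib_left)
qed

text \<open>Fermat's rule along each coordinate line through a global maximizer.\<close>

lemma block_objective_stationary:
  assumes eps: "0 < eps" and v: "\<And>j. j < n \<Longrightarrow> 0 \<le> v j" and c: "0 < c"
  shows "\<exists>x. \<forall>k<m. block_gradient m n eps A v c r x k = 0"
proof -
  obtain x where x: "\<forall>y. block_objective m n eps A v c r y \<le> block_objective m n eps A v c r x"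
    using block_objective_attains_max[OF eps v c] ..
  have "block_gradient m n eps A v c r x k = 0" if "k < m" for k
  proof -
    have deriv: "((\<lambda>s. block_objective m n eps A v c r (x(k := s))) has_real_derivative
        block_gradient m n eps A v c r x k) (at (x k))"
      using eps that by (intro block_objective_has_derivative) auto
    show ?thesis
      by (rule DERIV_local_max[OF deriv, of 1]) (use x in simp_all)
  qed
  then show ?thesis by blast
qed

section \<open>Indices, marginals and scalings\<close>

lemma finite_tensor_index [simp]: "finite (tensor_index T n)"
  by (simp add: tensor_index_def finite_PiE)

lemma tensor_index_less: "i \<in> tensor_index T n \<Longrightarrow> t \<le> T \<Longrightarrow> i t < n"
  by (auto simp: tensor_index_def)

lemma dim_marginal [simp]: "dim_vec (marginal T n t M) = n"
  by (simp add: marginal_def)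

lemma marginal_carrier [simp]: "marginal T n t M \<in> carrier_vec n"
  by (simp add: marginal_def)

lemma transpose_mult_index:
  assumes "G \<in> carrier_mat m n" "l \<in> carrier_vec m" "j < n"
  shows "(transpose_mat G *\<^sub>v l) $ j = (\<Sum>i<m. G $$ (i, j) * l $ i)"
  using assms by (auto simp: scalar_prod_def atLeast0LessThan intro!: sum.cong)

lemma scaling_index:
  assumes "G \<in> carrier_mat m n" "j < n"
  shows "scaling eps G l $ j = exp ((transpose_mat G *\<^sub>v l) $ j / eps)"
  using assms by (simp add: scaling_def)

text \<open>The multi-indices are grouped by their value in mode \<open>t\<close>, on which the
  weight alone depends.\<close>

lemma sum_marginal:
  assumes "t \<le> T"
  shows "(\<Sum>j<n. w j * marginal T n t M $ j) = (\<Sum>i\<in>tensor_index T n. w (i t) * M i)"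
proof -
  have "(\<Sum>j<n. w j * marginal T n t M $ j)
      = (\<Sum>j<n. \<Sum>i\<in>{i. i \<in> tensor_index T n \<and> i t = j}. w (i t) * M i)"
    by (intro sum.cong refl) (simp add: marginal_def sum_distrib_left)
  also have "\<dots> = (\<Sum>i\<in>tensor_index T n. w (i t) * M i)"
    using assms by (intro sum.group) (auto simp: tensor_index_less)
  finally show ?thesis .
qed

text \<open>The adjoint of \<open>M \<mapsto> G P_t(M)\<close>: it turns a multiplier of a marginal
  constraint into a linear term in the entries of \<open>M\<close>.\<close>

lemma scalar_prod_mult_marginal:
  assumes "t \<le> T" "G \<in> carrier_mat m n" "l \<in> carrier_vec m"
  shows "l \<bullet> (G *\<^sub>v marginal T n t M) = (\<Sum>i\<in>tensor_index T n. (transpose_mat G *\<^sub>v l) $ i t * M i)"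
proof -
  have "l \<bullet> (G *\<^sub>v marginal T n t M) = (transpose_mat G *\<^sub>v l) \<bullet> marginal T n t M"
    using assms by (subst transpose_vec_mult_scalar[of G m n]) auto
  also have "\<dots> = (\<Sum>j<n. (transpose_mat G *\<^sub>v l) $ j * marginal T n t M $ j)"
    by (simp add: scalar_prod_def atLeast0LessThan)
  finally show ?thesis using sum_marginal[OF assms(1)] by metis
qed

lemma dim_step_vector [simp]: "dim_vec (step_vector T n eps C G lam t) = n"
  by (simp add: step_vector_def vec_divide_def)

lemma sq_norm2_nonneg [simp]: "0 \<le> sq_norm2 v"
  by (simp add: sq_norm2_def sum_nonneg)

lemma sq_norm2_diff_eq_0:
  assumes "v \<in> carrier_vec k" "w \<in> carrier_vec k" "sq_norm2 (v - w) = 0"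
  shows "v = w"
  using assms by (auto simp: sq_norm2_def sum_nonneg_eq_0_iff intro!: eq_vecI)

section \<open>Scalar and quadratic minimizations behind the dual function\<close>

text \<open>The convex conjugate of the entropy of one entry. For \<open>z > 0\<close> it is the
  tangent inequality for \<open>exp\<close> at \<open>p / eps - ln z\<close>, multiplied by
  \<open>z\<close>; this argument vanishes at the minimizer
  \<open>z = exp (p / eps)\<close>.\<close>

lemma entropy_entry_ge:
  fixes z p eps :: real
  assumes "0 < eps" "0 \<le> z"
  shows "eps - eps * exp (p / eps) \<le> eps * (z * ln z - z + 1) - p * z"
proof (cases "z = 0")
  case False
  with assms have z: "0 < z" by simp
  have "z * (1 + (p / eps - ln z)) \<le> z * exp (p / eps - ln z)"
    using z by (intro mult_left_mono exp_ge_add_one_self) auto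
  also have "\<dots> = exp (p / eps)" using z by (simp add: exp_diff)
  finally have "eps * (z * (1 + (p / eps - ln z))) \<le> eps * exp (p / eps)"
    using assms by (intro mult_left_mono) auto
  moreover have "eps * (z * (1 + (p / eps - ln z))) = eps * z + p * z - eps * (z * ln z)"
    using assms by (simp add: field_simps)
  ultimately show ?thesis by (simp add: algebra_simps)
qed (use assms in simp)

lemma entropy_entry_exp:
  fixes p eps :: real
  assumes "0 < eps"
  shows "eps * (exp (p / eps) * ln (exp (p / eps)) - exp (p / eps) + 1) - p * exp (p / eps)
    = eps - eps * exp (p / eps)"
  using assms by (simp add: field_simps)

text \<open>Completing the square shows the minimizer \<open>d = - l / (2 * c)\<close> and produces
  the penalty on the multipliers in the dual.\<close>

lemma quadratic_scalar_prod:
  assumes "0 < c" "d \<in> carrier_vec k" "l \<in> carrier_vec k"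
  shows "c * sq_norm2 d + l \<bullet> d = c * sq_norm2 (d + (1 / (2 * c)) \<cdot>\<^sub>v l) - 1 / (4 * c) * sq_norm2 l"
proof -
  have "c * sq_norm2 d + l \<bullet> d = (\<Sum>i<k. c * (d $ i)\<^sup>2 + l $ i * d $ i)"
    using assms by (simp add: sq_norm2_def scalar_prod_def atLeast0LessThan sum_distrib_left sum.distrib)
  also have "\<dots> = (\<Sum>i<k. c * (d $ i + 1 / (2 * c) * l $ i)\<^sup>2 - 1 / (4 * c) * (l $ i)\<^sup>2)"
    using assms by (intro sum.cong refl) (simp add: field_simps power2_eq_square)
  also have "\<dots> = c * sq_norm2 (d + (1 / (2 * c)) \<cdot>\<^sub>v l) - 1 / (4 * c) * sq_norm2 l"
    using assms by (simp add: sq_norm2_def sum_subtractf sum_distrib_left)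
  finally show ?thesis .
qed

lemma cyclic_block_le: "cyclic_block T k \<le> T"
  by (simp add: cyclic_block_def less_Suc_eq_le[symmetric])

section \<open>The dual objective as a function of one block\<close>

locale partial_transport =
  fixes T n :: nat
    and m :: "nat \<Rightarrow> nat"
    and eps :: real
    and C :: tensor
    and G :: "nat \<Rightarrow> real mat"
    and r :: "nat \<Rightarrow> real vec"
    and gam :: "nat \<Rightarrow> real"
  assumes eps: "0 < eps"
    and G: "t \<le> T \<Longrightarrow> G t \<in> carrier_mat (m t) n"
    and r: "t \<le> T \<Longrightarrow> r t \<in> carrier_vec (m t)"
    and gam: "t \<le> T \<Longrightarrow> 0 < gam t"
begin

abbreviation "dual \<equiv> dual_objective T n eps C G r gam"

abbreviation "step lam t \<equiv> step_vector T n eps C G lam t"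

abbreviation "solves \<equiv> solves_step T n m eps C G r gam"

text \<open>The weights \<open>step lam t\<close> stay frozen at the current \<open>lam\<close>
  while \<open>l\<close> varies. With \<open>c = 1 / (4 * gam t)\<close> the factor
  \<open>2 * c\<close> in the gradient is the \<open>1 / (2 * gam t)\<close> of the update
  equation.\<close>

abbreviation "block_value lam t l \<equiv> block_objective (m t) n eps (\<lambda>i j. G t $$ (i, j)) (\<lambda>j. step lam t $ j)
  (1 / (4 * gam t)) (\<lambda>i. r t $ i) (\<lambda>i. l $ i)"

abbreviation "block_gradient_at lam t l \<equiv> block_gradient (m t) n eps (\<lambda>i j. G t $$ (i, j)) (\<lambda>j. step lam t $ j)
  (1 / (4 * gam t)) (\<lambda>i. r t $ i) (\<lambda>i. l $ i)"

lemma scaling_tensor_eq_exp: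
  assumes i: "i \<in> tensor_index T n"
  shows "scaling_tensor T eps G lam i = exp ((\<Sum>t\<le>T. (transpose_mat (G t) *\<^sub>v lam t) $ i t) / eps)"
proof -
  have "scaling_tensor T eps G lam i = (\<Prod>t\<le>T. exp ((transpose_mat (G t) *\<^sub>v lam t) $ i t / eps))"
    unfolding scaling_tensor_def tensor_prod_def
    by (intro prod.cong refl scaling_index[OF G tensor_index_less[OF i]]) auto
  then show ?thesis by (simp add: exp_sum sum_divide_distrib)
qed

lemma step_vector_index:
  assumes "t \<le> T" "j < n"
  shows "step lam t $ j =
    marginal T n t (tensor_mult (gibbs_kernel eps C) (scaling_tensor T eps G lam)) $ j
      / scaling eps (G t) (lam t) $ j"
  using assms by (simp add: step_vector_def vec_divide_def)

text \<open>Nonnegative weights are what the concavity estimate for the block objective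
  requires.\<close>

lemma step_vector_nonneg:
  assumes "t \<le> T" "j < n"
  shows "0 \<le> step lam t $ j"
proof -
  have "0 \<le> marginal T n t (tensor_mult (gibbs_kernel eps C) (scaling_tensor T eps G lam)) $ j"
    using assms by (auto simp: marginal_def tensor_mult_def gibbs_kernel_def scaling_tensor_eq_exp
        intro!: sum_nonneg)
  moreover have "0 \<le> scaling eps (G t) (lam t) $ j"
    unfolding scaling_index[OF G[OF assms(1)] assms(2)] by simp
  ultimately show ?thesis by (simp add: step_vector_index[OF assms])
qed

text \<open>The current block value cancels in \<open>v = P\<^sub>t(K \<odot> U) ./ u\<^sub>t\<close>, so \<open>\<langle>K, U\<rangle>\<close> depends on
  the updated block only through \<open>\<langle>v, u\<^sub>t\<rangle>\<close>.\<close>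

lemma tensor_inner_block_update:
  assumes t: "t \<le> T"
  shows "tensor_inner T n (gibbs_kernel eps C) (scaling_tensor T eps G (lam(t := \<mu>)))
    = (\<Sum>j<n. step lam t $ j * scaling eps (G t) \<mu> $ j)"
proof -
  let ?P = "marginal T n t (tensor_mult (gibbs_kernel eps C) (scaling_tensor T eps G lam))"
  let ?w = "\<lambda>j. scaling eps (G t) \<mu> $ j / scaling eps (G t) (lam t) $ j"
  \<comment> \<open>All factors but the one of mode \<open>t\<close> agree, so an entry changes by
    the ratio of new to old scaling; the old one is an exponential, hence nonzero.\<close>
  have "scaling_tensor T eps G (lam(t := \<mu>)) i = ?w (i t) * scaling_tensor T eps G lam i"
    if i: "i \<in> tensor_index T n" for i
  proof -
    have "scaling eps (G t) (lam t) $ i t \<noteq> 0"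
      using scaling_index[OF G[OF t] tensor_index_less[OF i t]] by simp
    moreover have "(\<Prod>s\<in>{..T} - {t}. scaling eps (G s) ((lam(t := \<mu>)) s) $ i s)
        = (\<Prod>s\<in>{..T} - {t}. scaling eps (G s) (lam s) $ i s)"
      by (intro prod.cong) auto
    ultimately show ?thesis
      using t unfolding scaling_tensor_def tensor_prod_def
      by (subst (1 2) prod.remove[of "{..T}" t]) auto
  qed
  then have "tensor_inner T n (gibbs_kernel eps C) (scaling_tensor T eps G (lam(t := \<mu>)))
      = (\<Sum>i\<in>tensor_index T n. ?w (i t) * tensor_mult (gibbs_kernel eps C) (scaling_tensor T eps G lam) i)"
    unfolding tensor_inner_def tensor_mult_def by (intro sum.cong refl) simp
  also have "\<dots> = (\<Sum>j<n. ?w j * ?P $ j)"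
    by (rule sum_marginal[OF t, symmetric])
  also have "\<dots> = (\<Sum>j<n. step lam t $ j * scaling eps (G t) \<mu> $ j)"
    by (intro sum.cong refl) (simp add: step_vector_index[OF t])
  finally show ?thesis .
qed

lemma scaling_index_sum:
  assumes "t \<le> T" "l \<in> carrier_vec (m t)" "j < n"
  shows "scaling eps (G t) l $ j = exp ((\<Sum>i<m t. G t $$ (i, j) * l $ i) / eps)"
  unfolding scaling_index[OF G[OF assms(1)] assms(3)]
    transpose_mult_index[OF G[OF assms(1)] assms(2,3)] ..

text \<open>The penalty and linear terms of the other blocks form \<open>a\<close>, which does not
  depend on \<mu>; maximizing over block \<open>t\<close> is therefore maximizing
  \<open>block_value\<close>.\<close>

lemma dual_objective_block:
  assumes t: "t \<le> T"
  shows "\<exists>a. \<forall>\<mu>\<in>carrier_vec (m t). dual (lam(t := \<mu>)) = block_value lam t \<mu> + a"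
proof (intro exI ballI)
  fix \<mu> :: "real vec"
  assume \<mu>: "\<mu> \<in> carrier_vec (m t)"
  have split: "(\<Sum>s\<le>T. f s ((lam(t := \<mu>)) s)) = f t \<mu> + (\<Sum>s\<in>{..T} - {t}. f s (lam s))"
    for f :: "nat \<Rightarrow> real vec \<Rightarrow> real"
  proof -
    have "(\<Sum>s\<le>T. f s ((lam(t := \<mu>)) s)) = f t \<mu> + (\<Sum>s\<in>{..T} - {t}. f s ((lam(t := \<mu>)) s))"
      using t by (subst sum.remove[of _ t]) auto
    also have "(\<Sum>s\<in>{..T} - {t}. f s ((lam(t := \<mu>)) s)) = (\<Sum>s\<in>{..T} - {t}. f s (lam s))"
      by (intro sum.cong) auto
    finally show ?thesis .
  qed
  have "tensor_inner T n (gibbs_kernel eps C) (scaling_tensor T eps G (lam(t := \<mu>)))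
      = (\<Sum>j<n. step lam t $ j * exp ((\<Sum>i<m t. G t $$ (i, j) * \<mu> $ i) / eps))"
    unfolding tensor_inner_block_update[OF t]
    by (intro sum.cong refl) (simp add: scaling_index_sum[OF t \<mu>])
  moreover have "sq_norm2 \<mu> = (\<Sum>i<m t. (\<mu> $ i)\<^sup>2)" "\<mu> \<bullet> r t = (\<Sum>i<m t. \<mu> $ i * r t $ i)"
    using \<mu> r[OF t] by (auto simp: sq_norm2_def scalar_prod_def atLeast0LessThan)
  ultimately show "dual (lam(t := \<mu>)) = block_value lam t \<mu>
      + ((\<Sum>s\<in>{..T} - {t}. lam s \<bullet> r s) - (\<Sum>s\<in>{..T} - {t}. 1 / (4 * gam s) * sq_norm2 (lam s)))"
    unfolding dual_objective_def block_objective_def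
      split[of "\<lambda>s l. 1 / (4 * gam s) * sq_norm2 l"] split[of "\<lambda>s l. l \<bullet> r s"]
    by simp
qed

section \<open>The update equation and the block maximizer\<close>

text \<open>The residual of the update equation is, coordinate by coordinate, minus the block
  gradient.\<close>

lemma solves_step_iff:
  assumes t: "t \<le> T"
  shows "solves lam t \<nu> \<longleftrightarrow> \<nu> \<in> carrier_vec (m t) \<and> (\<forall>k<m t. block_gradient_at lam t \<nu> k = 0)"
proof (cases "\<nu> \<in> carrier_vec (m t)")
  case True
  let ?R = "G t *\<^sub>v vec_mult (step lam t) (scaling eps (G t) \<nu>) + (1 / (2 * gam t)) \<cdot>\<^sub>v \<nu> - r t"
  have "?R $ k = - block_gradient_at lam t \<nu> k" if k: "k < m t" for k
  proof -
    have "(G t *\<^sub>v vec_mult (step lam t) (scaling eps (G t) \<nu>)) $ k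
        = (\<Sum>j<n. G t $$ (k, j) * (step lam t $ j * exp ((\<Sum>i<m t. G t $$ (i, j) * \<nu> $ i) / eps)))"
      using G[OF t] k by (auto simp: scalar_prod_def vec_mult_def atLeast0LessThan
          scaling_index_sum[OF t True] intro!: sum.cong)
    then show ?thesis
      using G[OF t] r[OF t] True k by (simp add: block_gradient_def)
  qed
  moreover have "dim_vec ?R = m t" using r[OF t] by simp
  ultimately have "?R = 0\<^sub>v (m t) \<longleftrightarrow> (\<forall>k<m t. block_gradient_at lam t \<nu> k = 0)"
    by (metis (no_types, lifting) eq_vecI index_zero_vec neg_equal_0_iff_equal)
  with True show ?thesis by (simp add: solves_step_def Let_def)
qed (simp add: solves_step_def)

lemma solves_step_exists:
  assumes t: "t \<le> T"
  shows "\<exists>\<nu>. solves lam t \<nu>"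
proof -
  let ?grad = "block_gradient (m t) n eps (\<lambda>i j. G t $$ (i, j)) (\<lambda>j. step lam t $ j)
    (1 / (4 * gam t)) (\<lambda>i. r t $ i)"
  have "0 < 1 / (4 * gam t)" using gam[OF t] by simp
  then obtain x where x: "\<forall>k<m t. ?grad x k = 0"
    using block_objective_stationary[where v = "\<lambda>j. step lam t $ j", OF eps step_vector_nonneg[OF t]]
    by blast
  \<comment> \<open>Turning the function \<open>x\<close> into a vector loses only coordinates from
    \<open>m t\<close> on, which the gradient does not see.\<close>
  have "?grad (\<lambda>i. vec (m t) x $ i) k = ?grad x k" if "k < m t" for k
    using that by (simp add: block_gradient_def)
  with x have "solves lam t (vec (m t) x)"
    by (simp add: solves_step_iff[OF t])
  then show ?thesis ..
qed

text \<open>At a stationary point the linear term of the concavity estimate vanishes. Keeping the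
  quadratic gap gives maximality and uniqueness at once.\<close>

lemma solves_step_gap:
  assumes t: "t \<le> T" and \<nu>: "solves lam t \<nu>" and \<mu>: "\<mu> \<in> carrier_vec (m t)"
  shows "dual (lam(t := \<mu>)) + 1 / (4 * gam t) * sq_norm2 (\<mu> - \<nu>) \<le> dual (lam(t := \<nu>))"
proof -
  have \<nu>': "\<nu> \<in> carrier_vec (m t)" "\<And>k. k < m t \<Longrightarrow> block_gradient_at lam t \<nu> k = 0"
    using \<nu> solves_step_iff[OF t] by blast+
  obtain a where a: "\<forall>\<mu>\<in>carrier_vec (m t). dual (lam(t := \<mu>)) = block_value lam t \<mu> + a"
    using dual_objective_block[OF t] ..
  have "block_value lam t \<mu> \<le> block_value lam t \<nu>
      + (\<Sum>k<m t. block_gradient_at lam t \<nu> k * (\<mu> $ k - \<nu> $ k))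
      - 1 / (4 * gam t) * (\<Sum>k<m t. (\<mu> $ k - \<nu> $ k)\<^sup>2)"
    by (rule block_objective_strongly_concave[OF eps step_vector_nonneg[OF t]])
  moreover have "(\<Sum>k<m t. block_gradient_at lam t \<nu> k * (\<mu> $ k - \<nu> $ k)) = 0"
    by (intro sum.neutral) (simp add: \<nu>')
  moreover have "1 / (4 * gam t) * (\<Sum>k<m t. (\<mu> $ k - \<nu> $ k)\<^sup>2) = 1 / (4 * gam t) * sq_norm2 (\<mu> - \<nu>)"
    using \<mu> \<nu>' by (simp add: sq_norm2_def)
  ultimately show ?thesis using bspec[OF a \<mu>] bspec[OF a \<nu>'(1)] by linarith
qed

lemma block_maximizer_iff:
  assumes t: "t \<le> T" and \<nu>: "solves lam t \<nu>"
  shows "block_maximizer m dual lam t \<mu> \<longleftrightarrow> \<mu> = \<nu>"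
proof -
  have \<nu>_carrier: "\<nu> \<in> carrier_vec (m t)" using \<nu> by (simp add: solves_step_def)
  have pen: "0 \<le> 1 / (4 * gam t) * sq_norm2 w" for w
    using gam[OF t] by simp
  have le: "dual (lam(t := \<mu>)) \<le> dual (lam(t := \<nu>))" if "\<mu> \<in> carrier_vec (m t)" for \<mu>
    using solves_step_gap[OF t \<nu> that] pen[of "\<mu> - \<nu>"] by linarith
  show ?thesis
  proof
    assume "block_maximizer m dual lam t \<mu>"
    then have \<mu>: "\<mu> \<in> carrier_vec (m t)" "\<not> dual (lam(t := \<mu>)) < dual (lam(t := \<nu>))"
      using \<nu>_carrier by (auto simp: block_maximizer_def is_arg_max_def)
    then have "1 / (4 * gam t) * sq_norm2 (\<mu> - \<nu>) = 0"
      using solves_step_gap[OF t \<nu> \<mu>(1)] pen[of "\<mu> - \<nu>"] by linarith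
    then have "sq_norm2 (\<mu> - \<nu>) = 0" using gam[OF t] by simp
    then show "\<mu> = \<nu>" by (rule sq_norm2_diff_eq_0[OF \<mu>(1) \<nu>_carrier])
  next
    assume "\<mu> = \<nu>"
    then show "block_maximizer m dual lam t \<mu>"
      using le \<nu>_carrier by (auto simp: block_maximizer_def is_arg_max_def not_less)
  qed
qed

text \<open>Two solutions would each be the only block maximizer, hence equal.\<close>

lemma solves_step_ex1:
  assumes "t \<le> T"
  shows "\<exists>!\<nu>. solves lam t \<nu>"
  using solves_step_exists[OF assms] block_maximizer_iff[OF assms] by metis

section \<open>The Lagrange dual function\<close>

text \<open>Adjoints move the multipliers onto the entries of \<open>M\<close>, and completing
  squares absorbs their coupling to \<Delta>. Each entry \<open>M i\<close> and each \<Delta>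
  \<open>t\<close> then occurs in a summand of its own.\<close>

lemma lagrangian_eq:
  assumes lam: "lam \<in> block_vectors T m" and D: "\<Delta> \<in> block_vectors T m"
  shows "primal_objective T n eps C gam (M, \<Delta>) + (\<Sum>t\<le>T. lam t \<bullet> primal_residual T n G r t (M, \<Delta>))
    = (\<Sum>i\<in>tensor_index T n. eps * (M i * ln (M i) - M i + 1)
          - ((\<Sum>t\<le>T. (transpose_mat (G t) *\<^sub>v lam t) $ i t) - C i) * M i)
      + (\<Sum>t\<le>T. gam t * sq_norm2 (\<Delta> t + (1 / (2 * gam t)) \<cdot>\<^sub>v lam t))
      - (\<Sum>t\<le>T. 1 / (4 * gam t) * sq_norm2 (lam t)) + (\<Sum>t\<le>T. lam t \<bullet> r t)"
proof -
  have "lam t \<bullet> primal_residual T n G r t (M, \<Delta>) + gam t * sq_norm2 (\<Delta> t)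
      = lam t \<bullet> r t + (gam t * sq_norm2 (\<Delta> t + (1 / (2 * gam t)) \<cdot>\<^sub>v lam t)
          - 1 / (4 * gam t) * sq_norm2 (lam t))
        - (\<Sum>i\<in>tensor_index T n. (transpose_mat (G t) *\<^sub>v lam t) $ i t * M i)" if t: "t \<le> T" for t
  proof -
    have [simp]: "lam t \<in> carrier_vec (m t)" "\<Delta> t \<in> carrier_vec (m t)"
      using lam D t by (auto simp: block_vectors_def)
    have "G t *\<^sub>v marginal T n t M \<in> carrier_vec (m t)"
      using G[OF t] by (intro mult_mat_vec_carrier[of _ _ n]) auto
    then have "lam t \<bullet> primal_residual T n G r t (M, \<Delta>)
        = lam t \<bullet> r t + lam t \<bullet> \<Delta> t - lam t \<bullet> (G t *\<^sub>v marginal T n t M)"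
      using r[OF t] by (simp add: primal_residual_def scalar_prod_minus_distrib[of _ "m t"]
          scalar_prod_add_distrib[of _ "m t"])
    then show ?thesis
      using quadratic_scalar_prod[OF gam[OF t], of "\<Delta> t" "m t" "lam t"]
        scalar_prod_mult_marginal[OF t G[OF t], of "lam t" M] by simp
  qed
  then have "(\<Sum>t\<le>T. lam t \<bullet> primal_residual T n G r t (M, \<Delta>) + gam t * sq_norm2 (\<Delta> t))
      = (\<Sum>t\<le>T. lam t \<bullet> r t + (gam t * sq_norm2 (\<Delta> t + (1 / (2 * gam t)) \<cdot>\<^sub>v lam t)
          - 1 / (4 * gam t) * sq_norm2 (lam t))
        - (\<Sum>i\<in>tensor_index T n. (transpose_mat (G t) *\<^sub>v lam t) $ i t * M i))"
    by (intro sum.cong) auto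
  moreover have "(\<Sum>t\<le>T. \<Sum>i\<in>tensor_index T n. (transpose_mat (G t) *\<^sub>v lam t) $ i t * M i)
      = (\<Sum>i\<in>tensor_index T n. (\<Sum>t\<le>T. (transpose_mat (G t) *\<^sub>v lam t) $ i t) * M i)"
    by (subst sum.swap) (simp add: sum_distrib_right)
  moreover have "(\<Sum>i\<in>tensor_index T n. eps * (M i * ln (M i) - M i + 1)
          - ((\<Sum>t\<le>T. (transpose_mat (G t) *\<^sub>v lam t) $ i t) - C i) * M i)
      = tensor_inner T n C M + eps * entropy T n M
        - (\<Sum>i\<in>tensor_index T n. (\<Sum>t\<le>T. (transpose_mat (G t) *\<^sub>v lam t) $ i t) * M i)"
    unfolding tensor_inner_def entropy_def sum_distrib_left[of eps] sum.distrib[symmetric]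
      sum_subtractf[symmetric]
    by (intro sum.cong refl) (simp add: left_diff_distrib)
  ultimately show ?thesis
    unfolding primal_objective_def by (simp add: sum.distrib sum_subtractf)
qed

text \<open>The separate lower bounds are attained simultaneously at \<open>?opt\<close>. The
  constant comes from the \<open>+ 1\<close> in the entropy, which contributes \<open>eps\<close>
  per multi-index.\<close>

lemma lagrange_dual_eq:
  assumes lam: "lam \<in> block_vectors T m"
  shows "lagrange_dual T (primal_domain T n m) (primal_objective T n eps C gam)
      (primal_residual T n G r) lam
    = ereal (dual lam + eps * card (tensor_index T n))"
proof -
  let ?X = "primal_domain T n m"
  let ?L = "\<lambda>x. primal_objective T n eps C gam x + (\<Sum>t\<le>T. lam t \<bullet> primal_residual T n G r t x)"
  \<comment> \<open>The entry of the kernel times the scaling tensor at \<open>i\<close> is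
    \<open>exp (p i / eps)\<close>.\<close>
  define p where "p i = (\<Sum>t\<le>T. (transpose_mat (G t) *\<^sub>v lam t) $ i t) - C i" for i
  define q where "q = (\<Sum>t\<le>T. lam t \<bullet> r t) - (\<Sum>t\<le>T. 1 / (4 * gam t) * sq_norm2 (lam t))"
  \<comment> \<open>The minimizers of the separate summands: the entropy terms give the
    exponentials, the squares give \<open>- lam t / (2 * gam t)\<close>.\<close>
  let ?opt = "(\<lambda>i. exp (p i / eps), \<lambda>t. (- 1 / (2 * gam t)) \<cdot>\<^sub>v lam t)"
  have L: "?L (M, \<Delta>) = (\<Sum>i\<in>tensor_index T n. eps * (M i * ln (M i) - M i + 1) - p i * M i)
      + (\<Sum>t\<le>T. gam t * sq_norm2 (\<Delta> t + (1 / (2 * gam t)) \<cdot>\<^sub>v lam t)) + q"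
    if "\<Delta> \<in> block_vectors T m" for M \<Delta>
    using lagrangian_eq[OF lam that]
    unfolding p_def q_def by simp
  have "tensor_inner T n (gibbs_kernel eps C) (scaling_tensor T eps G lam)
      = (\<Sum>i\<in>tensor_index T n. exp (p i / eps))"
    unfolding tensor_inner_def gibbs_kernel_def p_def
    by (intro sum.cong refl)
       (simp add: scaling_tensor_eq_exp exp_add[symmetric] diff_divide_distrib)
  then have dual_eq: "dual lam + eps * card (tensor_index T n)
      = (\<Sum>i\<in>tensor_index T n. eps - eps * exp (p i / eps)) + q"
    unfolding dual_objective_def q_def by (simp add: sum_subtractf sum_distrib_left sum_negf mult.commute)
  have opt_in: "?opt \<in> ?X"
    using lam by (auto simp: primal_domain_def block_vectors_def)
  have "sq_norm2 ((- 1 / (2 * gam t)) \<cdot>\<^sub>v lam t + (1 / (2 * gam t)) \<cdot>\<^sub>v lam t) = 0" for t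
    by (simp add: sq_norm2_def)
  then have opt: "?L ?opt = dual lam + eps * card (tensor_index T n)"
    using opt_in unfolding dual_eq
    by (subst L) (auto simp: primal_domain_def entropy_entry_exp[OF eps] simp del: ln_exp)
  have ge: "dual lam + eps * card (tensor_index T n) \<le> ?L x"
    if x: "x \<in> ?X" for x
  proof -
    obtain M \<Delta> where x_eq: "x = (M, \<Delta>)" by fastforce
    with x have M: "\<And>i. i \<in> tensor_index T n \<Longrightarrow> 0 \<le> M i" and D: "\<Delta> \<in> block_vectors T m"
      by (auto simp: primal_domain_def)
    have "(\<Sum>i\<in>tensor_index T n. eps - eps * exp (p i / eps))
        \<le> (\<Sum>i\<in>tensor_index T n. eps * (M i * ln (M i) - M i + 1) - p i * M i)"
      by (intro sum_mono entropy_entry_ge eps M)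
    moreover have "0 \<le> (\<Sum>t\<le>T. gam t * sq_norm2 (\<Delta> t + (1 / (2 * gam t)) \<cdot>\<^sub>v lam t))"
      using gam by (intro sum_nonneg mult_nonneg_nonneg) (auto simp: sq_norm2_def sum_nonneg less_imp_le)
    ultimately show ?thesis unfolding x_eq L[OF D] dual_eq by linarith
  qed
  show ?thesis
    unfolding lagrange_dual_def
  proof (rule antisym)
    show "(INF x\<in>?X. ereal (?L x))
        \<le> ereal (dual lam + eps * card (tensor_index T n))"
      using INF_lower[OF opt_in, of "\<lambda>x. ereal (?L x)"] unfolding opt .
    show "ereal (dual lam + eps * card (tensor_index T n))
        \<le> (INF x\<in>?X. ereal (?L x))"
      using ge by (intro INF_greatest) (simp only: ereal_less_eq)
  qed
qed

section \<open>The cyclic iteration\<close>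

lemma iteration_block_vectors:
  assumes "iteration T n m eps C G r gam lam0 x" "lam0 \<in> block_vectors T m"
  shows "x k \<in> block_vectors T m"
proof (induction k)
  case 0
  then show ?case using assms by (simp add: iteration_def)
next
  case (Suc k)
  obtain \<nu> where "solves (x k) (cyclic_block T k) \<nu>"
    "x (Suc k) = (x k)(cyclic_block T k := \<nu>)"
    using assms(1) by (auto simp: iteration_def)
  with Suc show ?case by (auto simp: block_vectors_def solves_step_def)
qed

text \<open>Since every update equation has exactly one solution, a step is a function of the
  current blocks and the iteration is a primitive recursion.\<close>

lemma iteration_ex1:
  shows "\<exists>!x. iteration T n m eps C G r gam lam0 x"
proof -
  define upd where "upd k lam =
    lam(cyclic_block T k := (THE \<nu>. solves lam (cyclic_block T k) \<nu>))" for k lam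
  have "(\<exists>\<nu>. solves lam (cyclic_block T k) \<nu> \<and>
      y = lam(cyclic_block T k := \<nu>)) \<longleftrightarrow> y = upd k lam" for lam k y
    using theI'[OF solves_step_ex1[OF cyclic_block_le]] the1_equality[OF solves_step_ex1[OF cyclic_block_le]]
    unfolding upd_def by metis
  then have iter: "iteration T n m eps C G r gam lam0 x \<longleftrightarrow>
      x 0 = lam0 \<and> (\<forall>k. x (Suc k) = upd k (x k))" for x
    by (simp add: iteration_def)
  show ?thesis
  proof (rule ex1I[of _ "rec_nat lam0 upd"])
    show "iteration T n m eps C G r gam lam0 (rec_nat lam0 upd)" by (simp add: iter)
  next
    fix x assume x: "iteration T n m eps C G r gam lam0 x"
    have "x k = rec_nat lam0 upd k" for k
      using x by (induction k) (auto simp: iter)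
    then show "x = rec_nat lam0 upd" by blast
  qed
qed

lemma iteration_block_coordinate_ascent:
  assumes "iteration T n m eps C G r gam lam0 x" "lam0 \<in> block_vectors T m"
  shows "block_coordinate_ascent T m dual (cyclic_block T) x"
  unfolding block_coordinate_ascent_def
proof (intro allI conjI)
  fix k
  obtain \<nu> where "solves (x k) (cyclic_block T k) \<nu>" "x (Suc k) = (x k)(cyclic_block T k := \<nu>)"
    using assms(1) by (auto simp: iteration_def)
  then show "\<exists>\<nu>. block_maximizer m dual (x k) (cyclic_block T k) \<nu> \<and>
      x (Suc k) = (x k)(cyclic_block T k := \<nu>)"
    using block_maximizer_iff[OF cyclic_block_le] by blast
qed (use cyclic_block_le iteration_block_vectors[OF assms] in auto)

end

theorem theorem1:
  fixes T n :: nat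
    and m :: "nat \<Rightarrow> nat"
    and eps :: real
    and C :: tensor
    and G :: "nat \<Rightarrow> real mat"
    and r :: "nat \<Rightarrow> real vec"
    and gam :: "nat \<Rightarrow> real"
  assumes "1 \<le> T" and "1 \<le> n" and "0 < eps"
    and "\<And>t. t \<le> T \<Longrightarrow> G t \<in> carrier_mat (m t) n"
    and "\<And>t. t \<le> T \<Longrightarrow> r t \<in> carrier_vec (m t)"
    and "\<And>t. t \<le> T \<Longrightarrow> 0 < gam t"
  shows
    "(\<exists>c::real. \<forall>lam\<in>block_vectors T m.
        lagrange_dual T (primal_domain T n m) (primal_objective T n eps C gam)
          (primal_residual T n G r) lam
        = ereal (dual_objective T n eps C G r gam lam + c))
     \<and> (\<forall>lam\<in>block_vectors T m. \<forall>t\<le>T.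
          (\<exists>!\<nu>. solves_step T n m eps C G r gam lam t \<nu>) \<and>
          (\<forall>\<nu>. solves_step T n m eps C G r gam lam t \<nu> \<longrightarrow>
             block_maximizer m (dual_objective T n eps C G r gam) lam t \<nu> \<and>
             (\<forall>\<mu>. block_maximizer m (dual_objective T n eps C G r gam) lam t \<mu> \<longrightarrow> \<mu> = \<nu>)))
     \<and> (\<forall>lam0\<in>block_vectors T m.
          (\<exists>!x. iteration T n m eps C G r gam lam0 x) \<and>
          (\<forall>x. iteration T n m eps C G r gam lam0 x \<longrightarrow>
             block_coordinate_ascent T m (dual_objective T n eps C G r gam) (cyclic_block T) x))"
proof -
  interpret partial_transport T n m eps C G r gam
    using assms(3-6) by unfold_locales
  show ?thesis
    \<comment> \<open>The additive constant is \<open>eps * card (tensor_index T n)\<close>, the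
      same for all \<open>lam\<close>.\<close>
    using lagrange_dual_eq solves_step_ex1 block_maximizer_iff iteration_ex1
      iteration_block_coordinate_ascent
    by blast
qed

end
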